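(* Let $\mathbb{G}$ be a vertex coloured ribbon graph. Then $T_{cps}(\mathbb{G};w,x,y)=T_s(\mathbb{G}^*;y,w,x)$, where $\mathbb{G}^*$ is the boundary coloured ribbon graph dual to $\mathbb{G}$.
   Context: A ribbon graph $\mathbb{G}=(V,E)$ is a surface with boundary represented as a union of two finite sets of closed discs, vertices and edges, meeting in disjoint line segments, each on the boundary of exactly one vertex and one edge, each edge containing exactly two such segments; $F(\mathbb{G})$ is its set of boundary components. The geometric dual $\mathbb{G}^*$ caps off each boundary component of $\mathbb{G}$ with a disc; these discs are its vertices and its edges are those of $\mathbb{G}$, so boundary components of $\mathbb{G}^*$ correspond to vertices of $\mathbb{G}$. A vertex coloured ribbon graph has a partition $\mathcal{V}$ of its vertex set into vertex colour classes; a boundary coloured ribbon graph has a partition $\mathcal{B}$ of its boundary components into boundary colour classes. The dual of a vertex coloured ribbon graph $\mathbb{G}$ is the boundary coloured ribbon graph $\mathbb{G}^*$ whose boundary colouring is induced from the vertex colouring of $\mathbb{G}$. Parameters (for a ribbon graph $\mathbb{H}=(V,E)$): $b(A)$ = number of boundary components of ribbon subgraph $(V,A)$; $\rho(A)=\frac12(|A|+|V|-b(A))$. For a graph $H$, $r_H(A)$ is the rank of its spanning subgraph with edges $A$. For vertex coloured $\mathbb{H}$: $\mathbb{H}/\mathcal{V}$ is the graph on the vertex colour classes with an edge for each edge joining the classes of its ends; $r_1(A)=r_{\mathbb{H}/\mathcal{V}}(A)$, $r_2(A)=\rho(A)-r_{\mathbb{H}/\mathcal{V}}(A)$, $T_{cps}(\mathbb{H};w,x,y)=\sum_{A\subseteq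 E}w^{r_1(E)-r_1(A)}x^{r_2(E)-r_2(A)}y^{|A|-\rho(A)}$. For boundary coloured $\mathbb{H}$: $\mathbb{H}^*/\mathcal{B}$ is the graph on the boundary colour classes with an edge for each edge $e$ joining the classes of the boundary components touching $e$; $r_3(A)=r_{\mathbb{H}^*/\mathcal{B}}(E)-r_{\mathbb{H}^*/\mathcal{B}}(E\setminus A)$, $r_4(A)=|A|+r_{\mathbb{H}^*/\mathcal{B}}(E\setminus A)-r_{\mathbb{H}^*/\mathcal{B}}(E)-\rho(A)$, $T_s(\mathbb{H};x,y,z)=\sum_{A\subseteq E}x^{\rho(E)-\rho(A)}y^{r_3(A)}z^{r_4(A)}$. *)

theory Defs
  imports
    "HOL-Analysis.Analysis"
    "HOL-Library.Disjoint_Sets"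
    "HOL-Library.Poly_Mapping"
begin

section \<open>Surfaces with boundary\<close>

definition half_plane :: "complex set" where
  "half_plane = {z. 0 \<le> Im z}"

definition surface_with_boundary :: "'a topology \<Rightarrow> bool" where
  "surface_with_boundary X \<longleftrightarrow>
     Hausdorff_space X \<and> second_countable X \<and>
     (\<forall>p \<in> topspace X. \<exists>U W. openin X U \<and> p \<in> U \<and>
        openin (top_of_set half_plane) W \<and>
        subtopology X U homeomorphic_space top_of_set W)"

definition surface_boundary :: "'a topology \<Rightarrow> 'a set" where
  "surface_boundary X =
     {p \<in> topspace X. \<not> (\<exists>U W. openin X U \<and> p \<in> U \<and> open (W :: complex set) \<and>
        subtopology X U homeomorphic_space top_of_set W)}"

definition closed_surface :: "'a topology \<Rightarrow> bool" where
  "closed_surface X \<longleftrightarrow>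
     surface_with_boundary X \<and> compact_space X \<and> surface_boundary X = {}"

definition boundary_components :: "'a topology \<Rightarrow> 'a set set" where
  "boundary_components X = connected_components_of (subtopology X (surface_boundary X))"

definition closed_disc_in :: "'a topology \<Rightarrow> 'a set \<Rightarrow> bool" where
  "closed_disc_in X D \<longleftrightarrow>
     D \<subseteq> topspace X \<and>
     subtopology X D homeomorphic_space top_of_set (cball (0 :: complex) 1)"

definition disc_boundary :: "'a topology \<Rightarrow> 'a set \<Rightarrow> 'a set" where
  "disc_boundary X D = surface_boundary (subtopology X D)"

definition line_segment_in :: "'a topology \<Rightarrow> 'a set \<Rightarrow> bool" where
  "line_segment_in X l \<longleftrightarrow>
     l \<subseteq> topspace X \<and> subtopology X l homeomorphic_space top_of_set {0 .. 1 :: real}"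


section \<open>Ribbon graphs\<close>

record 'a ribbon_graph =
  surface :: "'a topology"
  verts :: "'a set set"
  edges :: "'a set set"

text \<open>Distinct vertices are disjoint, and so are distinct edges: vertices and edges meet only
  in the segments of the set \<open>L\<close>.\<close>

definition ribbon_graph :: "'a ribbon_graph \<Rightarrow> bool" where
  "ribbon_graph G \<longleftrightarrow>
     surface_with_boundary (surface G) \<and>
     finite (verts G) \<and> finite (edges G) \<and>
     (\<forall>D \<in> verts G \<union> edges G. closed_disc_in (surface G) D) \<and>
     disjoint (verts G) \<and> disjoint (edges G) \<and>
     topspace (surface G) = \<Union>(verts G) \<union> \<Union>(edges G) \<and>
     (\<exists>L. \<Union>(verts G) \<inter> \<Union>(edges G) = \<Union>L \<and> disjoint L \<and>
        (\<forall>l \<in> L. line_segment_in (surface G) l \<and>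
           (\<exists>!v. v \<in> verts G \<and> l \<subseteq> disc_boundary (surface G) v) \<and>
           (\<exists>!e. e \<in> edges G \<and> l \<subseteq> disc_boundary (surface G) e)) \<and>
        (\<forall>e \<in> edges G. card {l \<in> L. l \<subseteq> e} = 2))"

text \<open>The surface underlying the ribbon subgraph \<open>(V, A)\<close>.\<close>

definition subgraph_surface :: "'a ribbon_graph \<Rightarrow> 'a set set \<Rightarrow> 'a topology" where
  "subgraph_surface G A = subtopology (surface G) (\<Union>(verts G) \<union> \<Union>A)"

definition num_boundary :: "'a ribbon_graph \<Rightarrow> 'a set set \<Rightarrow> nat" where
  "num_boundary G A = card (boundary_components (subgraph_surface G A))"

definition rho :: "'a ribbon_graph \<Rightarrow> 'a set set \<Rightarrow> rat" where
  "rho G A = (of_nat (card A) + of_nat (card (verts G)) - of_nat (num_boundary G A)) / 2"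


section \<open>Colourings and duality\<close>

definition vertex_coloured :: "'a ribbon_graph \<Rightarrow> 'a set set set \<Rightarrow> bool" where
  "vertex_coloured G \<V> \<longleftrightarrow> ribbon_graph G \<and> partition_on (verts G) \<V>"

text \<open>\<open>geometric_dual G i H\<close>: \<open>H\<close> is a geometric dual of \<open>G\<close>. The closed surface \<open>Y\<close> is
  obtained from (the image under the embedding \<open>i\<close> of) the surface of \<open>G\<close> by capping off every
  boundary component with exactly one disc; these discs are the vertices of \<open>H\<close>, its edges are
  those of \<open>G\<close>, and its surface is the union of these discs in \<open>Y\<close>. Such a capping is
  determined only up to homeomorphism, hence a relation. The points of \<open>H\<close> may have another
  type than those of \<open>G\<close>, so that there is always room for the new discs.\<close>

definition geometric_dual :: "'a ribbon_graph \<Rightarrow> ('a \<Rightarrow> 'b) \<Rightarrow> 'b ribbon_graph \<Rightarrow> bool" where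
  "geometric_dual G i H \<longleftrightarrow>
     (\<exists>Y. closed_surface Y \<and>
        embedding_map (surface G) Y i \<and>
        topspace Y = i ` topspace (surface G) \<union> \<Union>(verts H) \<and>
        finite (verts H) \<and> disjoint (verts H) \<and>
        (\<forall>D \<in> verts H. closed_disc_in Y D \<and>
           D \<inter> i ` topspace (surface G) = disc_boundary Y D) \<and>
        bij_betw (disc_boundary Y) (verts H) ((`) i ` boundary_components (surface G)) \<and>
        edges H = (`) i ` edges G \<and>
        surface H = subtopology Y (\<Union>(verts H) \<union> \<Union>(edges H)))"

text \<open>The boundary components of the dual are the boundary circles of the vertices of \<open>G\<close>;
  two of them have the same colour iff the vertices have.\<close>

definition dual_colouring :: "'a ribbon_graph \<Rightarrow> ('a \<Rightarrow> 'b) \<Rightarrow> 'a set set set \<Rightarrow> 'b set set set" where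
  "dual_colouring G i \<V> = (\<lambda>c. (\<lambda>v. i ` disc_boundary (surface G) v) ` c) ` \<V>"

definition coloured_dual ::
  "'a ribbon_graph \<Rightarrow> 'a set set set \<Rightarrow> 'b ribbon_graph \<Rightarrow> 'b set set set \<Rightarrow> bool" where
  "coloured_dual G \<V> H \<B> \<longleftrightarrow> (\<exists>i. geometric_dual G i H \<and> \<B> = dual_colouring G i \<V>)"


section \<open>Graphs and their rank\<close>

record ('v, 'e) multigraph =
  nodes :: "'v set"
  links :: "'e set"
  ends :: "'e \<Rightarrow> 'v set"  \<comment> \<open>a singleton for a loop\<close>

definition graph_components :: "('v, 'e) multigraph \<Rightarrow> 'v set set" where
  "graph_components H =
     nodes H // {(u, v) \<in> nodes H \<times> nodes H.
                   (u, v) \<in> {(a, b). \<exists>e \<in> links H. ends H e = {a, b}}\<^sup>*}"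

definition spanning_subgraph :: "('v, 'e) multigraph \<Rightarrow> 'e set \<Rightarrow> ('v, 'e) multigraph" where
  "spanning_subgraph H A = H\<lparr>links := A\<rparr>"

definition graph_rank :: "('v, 'e) multigraph \<Rightarrow> 'e set \<Rightarrow> rat" where
  "graph_rank H A =
     of_nat (card (nodes H)) - of_nat (card (graph_components (spanning_subgraph H A)))"

definition vertex_class_graph ::
  "'a ribbon_graph \<Rightarrow> 'a set set set \<Rightarrow> ('a set set, 'a set) multigraph" where
  "vertex_class_graph G \<V> =
     \<lparr>nodes = \<V>, links = edges G, ends = (\<lambda>e. {c \<in> \<V>. \<exists>v \<in> c. v \<inter> e \<noteq> {}})\<rparr>"

text \<open>The classes in \<open>\<B>\<close> consist of boundary components of \<open>H\<close>.\<close>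

definition boundary_class_graph ::
  "'a ribbon_graph \<Rightarrow> 'a set set set \<Rightarrow> ('a set set, 'a set) multigraph" where
  "boundary_class_graph H \<B> =
     \<lparr>nodes = \<B>, links = edges H, ends = (\<lambda>e. {c \<in> \<B>. \<exists>C \<in> c. C \<inter> e \<noteq> {}})\<rparr>"


section \<open>The two polynomials\<close>

text \<open>The function \<open>rho\<close> takes values in the half-integers (for instance \<open>1/2\<close> on a
  non-orientable loop), so the polynomials are formal: a monomial maps each variable to its
  rational exponent, and a polynomial maps monomials to integer coefficients. The arguments
  \<open>w\<close>, \<open>x\<close>, \<open>y\<close>, \<open>z\<close> below are variables.\<close>

type_synonym 'v monomial = "'v \<Rightarrow>\<^sub>0 rat"
type_synonym 'v polynomial = "'v monomial \<Rightarrow>\<^sub>0 int"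

definition var_power :: "'v \<Rightarrow> rat \<Rightarrow> 'v polynomial" where
  "var_power v q = Poly_Mapping.single (Poly_Mapping.single v q) 1"

definition rank1 :: "'a ribbon_graph \<Rightarrow> 'a set set set \<Rightarrow> 'a set set \<Rightarrow> rat" where
  "rank1 H \<V> A = graph_rank (vertex_class_graph H \<V>) A"

definition rank2 :: "'a ribbon_graph \<Rightarrow> 'a set set set \<Rightarrow> 'a set set \<Rightarrow> rat" where
  "rank2 H \<V> A = rho H A - graph_rank (vertex_class_graph H \<V>) A"

definition rank3 :: "'a ribbon_graph \<Rightarrow> 'a set set set \<Rightarrow> 'a set set \<Rightarrow> rat" where
  "rank3 H \<B> A =
     graph_rank (boundary_class_graph H \<B>) (edges H)
     - graph_rank (boundary_class_graph H \<B>) (edges H - A)"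

definition rank4 :: "'a ribbon_graph \<Rightarrow> 'a set set set \<Rightarrow> 'a set set \<Rightarrow> rat" where
  "rank4 H \<B> A =
     of_nat (card A) + graph_rank (boundary_class_graph H \<B>) (edges H - A)
     - graph_rank (boundary_class_graph H \<B>) (edges H) - rho H A"

definition T_cps ::
  "'a ribbon_graph \<Rightarrow> 'a set set set \<Rightarrow> 'v \<Rightarrow> 'v \<Rightarrow> 'v \<Rightarrow> 'v polynomial" where
  "T_cps H \<V> w x y =
     (\<Sum>A \<in> Pow (edges H).
        var_power w (rank1 H \<V> (edges H) - rank1 H \<V> A) *
        var_power x (rank2 H \<V> (edges H) - rank2 H \<V> A) *
        var_power y (of_nat (card A) - rho H A))"

definition T_s ::
  "'a ribbon_graph \<Rightarrow> 'a set set set \<Rightarrow> 'v \<Rightarrow> 'v \<Rightarrow> 'v \<Rightarrow> 'v polynomial" where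
  "T_s H \<B> x y z =
     (\<Sum>A \<in> Pow (edges H).
        var_power x (rho H (edges H) - rho H A) *
        var_power y (rank3 H \<B> A) *
        var_power z (rank4 H \<B> A))"

end

(*
  Let Y be the closed surface containing both G and its dual. Its discs (vertices and edges of G,
  caps) have pairwise disjoint interiors, and every disc is the closure of its interior. By
  invariance of domain the boundary of a subsurface S of Y is S minus its interior in Y. Hence the
  union of V(G) and A and the union of the caps and E - A have the same boundary, namely their
  intersection, so b(A) for G equals b(E - A) for the dual. Together with b({}) = |V(G)| and the
  isomorphism between the two graphs on colour classes, this makes the summand of T_cps at A equal
  to the summand of T_s at E - A.
*)

theory Submission
  imports Defs
begin

section \<open>Boundaries of subsurfaces\<close>

lemma surface_boundary_subset: "surface_boundary X \<subseteq> topspace X"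
  by (auto simp: surface_boundary_def)

text \<open>A homeomorphism carries a planar neighbourhood of \<open>p\<close> to a planar
  neighbourhood of \<open>f p\<close>. Applying this to \<open>f\<close> and to its inverse shows
  that boundary points correspond exactly.\<close>

lemma surface_boundary_homeomorphic_map:
  assumes "homeomorphic_map X X' f"
  shows "surface_boundary X' = f ` surface_boundary X"
proof -
  \<comment> \<open>Stated for arbitrary spaces of two fresh types, so that it serves both for
    \<open>f\<close> and for the inverse \<open>g\<close>, which runs in the opposite
    direction.\<close>
  have planar: "\<exists>U W. openin X' U \<and> f p \<in> U \<and> open (W :: complex set) \<and>
      subtopology X' U homeomorphic_space top_of_set W"
    if "homeomorphic_map X X' f" "openin X U" "p \<in> U" "open W"
      "subtopology X U homeomorphic_space top_of_set W"
    for X :: "'c topology" and X' :: "'d topology" and f p U and W :: "complex set"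
  proof -
    have "U \<subseteq> topspace X"
      using that(2) by (rule openin_subset)
    then have "homeomorphic_map (subtopology X U) (subtopology X' (f ` U)) f"
      using homeomorphic_imp_surjective_map[OF that(1)]
      by (intro homeomorphic_map_subtopologies[OF that(1)]) blast
    then have "subtopology X' (f ` U) homeomorphic_space subtopology X U"
      using homeomorphic_map_imp_homeomorphic_space homeomorphic_space_sym by blast
    moreover have "openin X' (f ` U)"
      using that homeomorphic_map_openness_eq by blast
    ultimately show ?thesis
      using that(3,4) homeomorphic_space_trans[OF _ that(5)] by (metis imageI)
  qed
  obtain g where fg: "homeomorphic_maps X X' f g"
    using assms homeomorphic_map_maps by blast
  then have g: "homeomorphic_map X' X g" and gf: "\<And>x. x \<in> topspace X \<Longrightarrow> g (f x) = x"
    by (auto simp: homeomorphic_maps_map)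
  have iff: "f x \<in> surface_boundary X' \<longleftrightarrow> x \<in> surface_boundary X" if "x \<in> topspace X" for x
  proof -
    have "f x \<in> topspace X'"
      using that homeomorphic_imp_surjective_map[OF assms] by blast
    then show ?thesis
      using that planar[OF assms, of _ x] planar[OF g, of _ "f x"] gf[OF that]
      unfolding surface_boundary_def mem_Collect_eq by metis
  qed
  have "surface_boundary X' \<subseteq> f ` topspace X"
    using surface_boundary_subset homeomorphic_imp_surjective_map[OF assms] by simp
  then have "surface_boundary X' = f ` {x \<in> topspace X. f x \<in> surface_boundary X'}"
    by auto
  also have "{x \<in> topspace X. f x \<in> surface_boundary X'} = surface_boundary X"
    using iff surface_boundary_subset[of X] by auto
  finally show ?thesis .
qed

text \<open>A point of \<open>S\<close> with a planar neighbourhood in \<open>S\<close> is an interior point of \<open>S\<close>, by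
  invariance of domain.\<close>

lemma surface_boundary_subtopology:
  assumes "surface_boundary Y = {}" and "S \<subseteq> topspace Y"
  shows "surface_boundary (subtopology Y S) = S - Y interior_of S"
proof -
  have chart: "\<exists>U W. openin Y U \<and> p \<in> U \<and> open (W :: complex set) \<and>
      subtopology Y U homeomorphic_space top_of_set W" if "p \<in> topspace Y" for p
    using assms(1) that unfolding surface_boundary_def by blast
  have "p \<in> Y interior_of S"
    if U': "openin (subtopology Y S) U'" "p \<in> U'" "open W'"
      "subtopology (subtopology Y S) U' homeomorphic_space top_of_set W'"
    for p U' and W' :: "complex set"
  proof -
    have U'S: "U' \<subseteq> S"
      using U'(1) assms(2) openin_subset by fastforce
    then have "p \<in> topspace Y"
      using U'(2) assms(2) by blast
    then obtain U W where U: "openin Y U" "p \<in> U" "open (W :: complex set)"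
      "subtopology Y U homeomorphic_space top_of_set W"
      using chart by metis
    have UY: "U \<subseteq> topspace Y"
      using U(1) by (rule openin_subset)
    obtain f where f: "homeomorphic_map (subtopology Y U) (top_of_set W) f"
      using U(4) homeomorphic_space by blast
    have "subtopology (subtopology Y S) U' = subtopology Y U'"
      using U'S by (simp add: subtopology_subtopology inf_absorb2)
    then have "top_of_set W' homeomorphic_space subtopology Y U'"
      using U'(4) homeomorphic_space_sym by metis
    then obtain h where h: "homeomorphic_map (top_of_set W') (subtopology Y U') h"
      using homeomorphic_space by blast
    have hW': "h ` W' = U'"
      using homeomorphic_imp_surjective_map[OF h] U'S assms(2) by auto
    have injh: "inj_on h W'"
      using homeomorphic_imp_injective_map[OF h] by simp
    \<comment> \<open>The part of \<open>W'\<close> on which the chart \<open>f\<close> of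
      \<open>Y\<close> can follow \<open>h\<close>. There \<open>f \<circ> h\<close> is a continuous
      injection from an open subset of the plane into the plane, so its image is open; pulling back
      along \<open>f\<close> makes \<open>U' \<inter> U\<close> open in \<open>Y\<close>.\<close>
    define W'' where "W'' = {w \<in> W'. h w \<in> U}"
    have "openin (subtopology Y U') (U' \<inter> U)"
      using U(1) by (simp add: openin_subtopology_Int2)
    then have "openin (top_of_set W') {w \<in> topspace (top_of_set W'). h w \<in> U' \<inter> U}"
      using homeomorphic_imp_continuous_map[OF h] openin_continuous_map_preimage by blast
    moreover have "{w \<in> topspace (top_of_set W'). h w \<in> U' \<inter> U} = W''"
      using hW' by (auto simp: W''_def)
    ultimately have "open W''"
      using U'(3) by (simp add: openin_open_eq)
    have hW'': "h ` W'' = U' \<inter> U"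
      using hW' by (auto simp: W''_def)
    have "continuous_map (top_of_set W'') (subtopology Y U') h"
      using homeomorphic_imp_continuous_map[OF h] continuous_map_from_subtopology_mono
      by (metis (no_types, lifting) W''_def mem_Collect_eq subsetI)
    then have "continuous_map (top_of_set W'') Y h"
      by (simp add: continuous_map_in_subtopology)
    then have "continuous_map (top_of_set W'') (subtopology Y U) h"
      using hW'' by (auto simp: continuous_map_in_subtopology)
    then have "continuous_map (top_of_set W'') (top_of_set W) (f \<circ> h)"
      using homeomorphic_imp_continuous_map[OF f] continuous_map_compose by blast
    then have "continuous_on W'' (f \<circ> h)"
      by (simp add: continuous_map_in_subtopology)
    moreover have "inj_on (f \<circ> h) W''"
    proof (rule comp_inj_on)
      show "inj_on h W''"
        using injh by (rule inj_on_subset) (auto simp: W''_def)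
      show "inj_on f (h ` W'')"
        using homeomorphic_imp_injective_map[OF f] hW'' UY
        by (auto intro: inj_on_subset)
    qed
    ultimately have "open ((f \<circ> h) ` W'')"
      using \<open>open W''\<close> invariance_of_domain by blast
    then have "open (f ` (U' \<inter> U))"
      by (metis hW'' image_comp)
    moreover have "f ` (U' \<inter> U) \<subseteq> W"
      using homeomorphic_imp_surjective_map[OF f] UY by auto
    ultimately have "openin (top_of_set W) (f ` (U' \<inter> U))"
      by (simp add: open_subset)
    then have "openin (subtopology Y U) (U' \<inter> U)"
      using homeomorphic_map_openness[OF f, of "U' \<inter> U"] UY by auto
    then have "openin Y (U' \<inter> U)"
      using U(1) openin_trans_full by blast
    then show ?thesis
      using U'(2) U(2) U'S unfolding interior_of_def by blast
  qed
  \<comment> \<open>Conversely, a chart of \<open>Y\<close> at an interior point of \<open>S\<close>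
    restricts to the interior of \<open>S\<close>.\<close>
  moreover have "\<exists>U' W'. openin (subtopology Y S) U' \<and> p \<in> U' \<and> open (W' :: complex set) \<and>
      subtopology (subtopology Y S) U' homeomorphic_space top_of_set W'"
    if "p \<in> Y interior_of S" for p
  proof -
    define N where "N = Y interior_of S"
    have N: "openin Y N" "p \<in> N" "N \<subseteq> S"
      using that interior_of_subset[of Y S] by (simp_all add: N_def)
    then have "p \<in> topspace Y"
      using assms(2) by blast
    then obtain U W where U: "openin Y U" "p \<in> U" "open (W :: complex set)"
      "subtopology Y U homeomorphic_space top_of_set W"
      using chart by metis
    have UY: "U \<subseteq> topspace Y"
      using U(1) by (rule openin_subset)
    obtain f where f: "homeomorphic_map (subtopology Y U) (top_of_set W) f"
      using U(4) homeomorphic_space by blast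
    have "openin (subtopology Y U) (U \<inter> N)"
      using N(1) by (simp add: openin_subtopology_Int2)
    then have "openin (top_of_set W) (f ` (U \<inter> N))"
      using homeomorphic_map_openness_eq[OF f] by blast
    then have "open (f ` (U \<inter> N))" and sub: "f ` (U \<inter> N) \<subseteq> W"
      using U(3) by (auto simp: openin_open_eq)
    have "homeomorphic_map (subtopology (subtopology Y U) (U \<inter> N))
        (subtopology (top_of_set W) (f ` (U \<inter> N))) f"
      using UY sub by (intro homeomorphic_map_subtopologies[OF f]) auto
    then have "homeomorphic_map (subtopology Y (U \<inter> N)) (top_of_set (f ` (U \<inter> N))) f"
      using sub by (simp add: subtopology_subtopology inf_absorb2)
    moreover have "subtopology (subtopology Y S) (U \<inter> N) = subtopology Y (U \<inter> N)"
      using N(3) by (simp add: subtopology_subtopology inf_absorb2 le_infI2)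
    ultimately have "subtopology (subtopology Y S) (U \<inter> N)
        homeomorphic_space top_of_set (f ` (U \<inter> N))"
      using homeomorphic_map_imp_homeomorphic_space by metis
    moreover have "openin (subtopology Y S) (U \<inter> N)"
      using N U(1) by (auto simp: openin_subtopology intro!: exI[of _ "U \<inter> N"])
    ultimately show ?thesis
      using N(2) U(2) \<open>open (f ` (U \<inter> N))\<close> by blast
  qed
  ultimately have "p \<in> surface_boundary (subtopology Y S) \<longleftrightarrow> p \<in> S \<and> p \<notin> Y interior_of S" for p
    using assms(2) unfolding surface_boundary_def mem_Collect_eq
    by (metis inf_absorb2 topspace_subtopology)
  then show ?thesis by blast
qed

section \<open>Discs in a surface without boundary\<close>

text \<open>The plane is itself a surface without boundary, so the boundary of the unit disc is the
  disc minus its interior in the plane.\<close>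

lemma surface_boundary_cball: "surface_boundary (top_of_set (cball (0 :: complex) 1)) = sphere 0 1"
proof -
  have "p \<notin> surface_boundary euclidean" for p :: complex
    unfolding surface_boundary_def mem_Collect_eq
    using homeomorphic_space_refl[of "top_of_set (UNIV :: complex set)"]
    by (metis (no_types, lifting) UNIV_I open_UNIV open_openin)
  then have "surface_boundary (euclidean :: complex topology) = {}"
    by blast
  then show ?thesis
    by (simp add: surface_boundary_subtopology cball_diff_eq_sphere)
qed

text \<open>A parametrisation through which facts about the unit circle and the unit ball pass to
  any disc.\<close>

lemma disc_boundary_homeomorphic:
  assumes "closed_disc_in X D"
  obtains f where "homeomorphic_map (top_of_set (cball 0 1)) (subtopology X D) f"
    "f ` sphere (0 :: complex) 1 = disc_boundary X D" "f ` cball 0 1 = D"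
proof -
  have "top_of_set (cball (0 :: complex) 1) homeomorphic_space subtopology X D"
    using assms homeomorphic_space_sym unfolding closed_disc_in_def by blast
  then obtain f where f: "homeomorphic_map (top_of_set (cball (0 :: complex) 1)) (subtopology X D) f"
    using homeomorphic_space by blast
  have "f ` sphere 0 1 = disc_boundary X D"
    using surface_boundary_homeomorphic_map[OF f] by (simp add: surface_boundary_cball disc_boundary_def)
  moreover have "D \<subseteq> topspace X"
    using assms by (simp add: closed_disc_in_def)
  then have "f ` cball 0 1 = D"
    using homeomorphic_imp_surjective_map[OF f] by (simp add: inf_absorb2)
  ultimately show thesis
    by (rule that[OF f])
qed

lemma disc_boundary_subset: "closed_disc_in X D \<Longrightarrow> disc_boundary X D \<subseteq> D"
  unfolding disc_boundary_def
  by (metis surface_boundary_subset topspace_subtopology le_inf_iff)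

lemma disc_boundary_nonempty:
  assumes "closed_disc_in X D"
  shows "disc_boundary X D \<noteq> {}"
proof -
  obtain f where "homeomorphic_map (top_of_set (cball (0 :: complex) 1)) (subtopology X D) f"
    and im: "f ` sphere 0 1 = disc_boundary X D"
    by (rule disc_boundary_homeomorphic[OF assms])
  have "1 \<in> sphere (0 :: complex) 1" by simp
  then show ?thesis
    using im by (metis empty_iff image_is_empty)
qed

lemma connectedin_disc_boundary:
  assumes "closed_disc_in X D"
  shows "connectedin X (disc_boundary X D)"
proof -
  obtain f where f: "homeomorphic_map (top_of_set (cball (0 :: complex) 1)) (subtopology X D) f"
    and im: "f ` sphere 0 1 = disc_boundary X D"
    by (rule disc_boundary_homeomorphic[OF assms])
  have "connectedin (top_of_set (cball (0 :: complex) 1)) (sphere 0 1)"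
    by (simp add: connectedin_subtopology connected_sphere)
  then have "connectedin (subtopology X D) (disc_boundary X D)"
    using homeomorphic_map_connectedness_eq[OF f, of "sphere 0 1"] im by simp
  then show ?thesis
    by (simp add: connectedin_subtopology)
qed

lemma closedin_disc:
  assumes "Hausdorff_space X" and "closed_disc_in X D"
  shows "closedin X D"
proof -
  have "compact_space (top_of_set (cball (0 :: complex) 1))"
    by (intro compact_space_subtopology) simp
  then have "compact_space (subtopology X D)"
    using assms(2) homeomorphic_compact_space unfolding closed_disc_in_def by blast
  then have "compactin X D"
    using assms(2) by (simp add: compactin_subspace closed_disc_in_def)
  then show ?thesis
    using assms(1) compactin_imp_closedin by blast
qed

lemma disc_boundary_eq:
  assumes "surface_boundary Y = {}" and "closed_disc_in Y D"
  shows "disc_boundary Y D = D - Y interior_of D"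
  using assms surface_boundary_subtopology unfolding disc_boundary_def closed_disc_in_def by blast

text \<open>The open unit ball is dense in the closed one. A parametrisation of \<open>D\<close>
  sends the circle to the boundary of \<open>D\<close>, hence the open ball onto the interior of
  \<open>D\<close> in \<open>Y\<close>.\<close>

lemma disc_subset_closure_of_interior:
  assumes "surface_boundary Y = {}" and "closed_disc_in Y D"
  shows "D \<subseteq> Y closure_of (Y interior_of D)"
proof -
  obtain f where f: "homeomorphic_map (top_of_set (cball (0 :: complex) 1)) (subtopology Y D) f"
    and sph: "f ` sphere 0 1 = disc_boundary Y D" and im: "f ` cball 0 1 = D"
    by (rule disc_boundary_homeomorphic[OF assms(2)])
  have "inj_on f (cball 0 1)"
    using homeomorphic_imp_injective_map[OF f] by simp
  then have "f ` ball 0 1 = f ` cball 0 1 - f ` sphere 0 1"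
    by (metis cball_diff_sphere inj_on_image_set_diff Diff_subset sphere_cball)
  also have "\<dots> = Y interior_of D"
    using disc_boundary_eq[OF assms] sph im interior_of_subset[of Y D] by blast
  finally have ball: "f ` ball 0 1 = Y interior_of D" .
  have "(top_of_set (cball (0 :: complex) 1)) closure_of (ball 0 1) = cball 0 1"
    by (simp add: closure_of_subtopology inf_absorb2 ball_subset_cball)
  then have "subtopology Y D closure_of (Y interior_of D) = D"
    using homeomorphic_map_closure_of[OF f, of "ball 0 1"] ball im by (simp add: ball_subset_cball)
  then show ?thesis
    by (metis closure_of_subtopology_subset)
qed

text \<open>An open set that misses the interior of \<open>d\<close> also misses the closure of that
  interior, which contains \<open>d\<close>.\<close>

lemma disc_inter_empty_if_interiors_disjoint:
  assumes "surface_boundary Y = {}" and "closed_disc_in Y d"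
    and "Y interior_of c \<inter> Y interior_of d = {}"
  shows "Y interior_of c \<inter> d = {}"
  using assms(3) disc_subset_closure_of_interior[OF assms(1,2)]
    openin_Int_closure_of_eq_empty[OF openin_interior_of, of Y c "Y interior_of d"]
  by blast

section \<open>A closed surface tiled by discs\<close>

text \<open>Points outside the closed set \<open>\<Union>Q\<close> are interior to
  \<open>\<Union>P\<close>. A point of some \<open>d\<close> in \<open>Q\<close> is a limit of
  interior points of \<open>d\<close>, and none of those lies in a disc of \<open>P\<close>, so the
  point is not interior to \<open>\<Union>P\<close>.\<close>

lemma Union_discs_minus_interior:
  assumes Y: "surface_boundary Y = {}" "Hausdorff_space Y"
    and Q: "finite Q" "\<And>d. d \<in> Q \<Longrightarrow> closed_disc_in Y d"
    and P: "\<And>c. c \<in> P \<Longrightarrow> closed_disc_in Y c"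
    and cover: "\<Union>P \<union> \<Union>Q = topspace Y"
    and dis: "\<And>c d. \<lbrakk>c \<in> P; d \<in> Q\<rbrakk> \<Longrightarrow> Y interior_of c \<inter> Y interior_of d = {}"
  shows "\<Union>P - Y interior_of \<Union>P = \<Union>P \<inter> \<Union>Q"
proof -
  have "closedin Y (\<Union>Q)"
    using Q closedin_disc[OF Y(2)] by (intro closedin_Union) auto
  then have "openin Y (topspace Y - \<Union>Q)"
    by blast
  then have "topspace Y - \<Union>Q \<subseteq> Y interior_of \<Union>P"
    using cover by (intro interior_of_maximal) auto
  moreover have "p \<notin> Y interior_of \<Union>P" if "d \<in> Q" "p \<in> d" for p d
  proof
    assume p: "p \<in> Y interior_of \<Union>P"
    have "p \<in> Y closure_of (Y interior_of d)"
      using disc_subset_closure_of_interior[OF Y(1) Q(2)] that by blast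
    then have "Y interior_of \<Union>P \<inter> Y interior_of d \<noteq> {}"
      using p openin_Int_closure_of_eq_empty[OF openin_interior_of, of Y "\<Union>P" "Y interior_of d"]
      by blast
    then obtain c where "c \<in> P" "c \<inter> Y interior_of d \<noteq> {}"
      using interior_of_subset[of Y "\<Union>P"] by blast
    \<comment> \<open>Density of interiors is used a second time, now for the disc
      \<open>c\<close>.\<close>
    moreover have "Y interior_of d \<inter> c = {}" if "c \<in> P" for c
      using disc_inter_empty_if_interiors_disjoint[OF Y(1) P[OF that], of d] dis[OF that \<open>d \<in> Q\<close>]
      by blast
    ultimately show False by blast
  qed
  moreover have "\<Union>P \<subseteq> topspace Y"
    using cover by blast
  ultimately show ?thesis by blast
qed

text \<open>The complement of a piece is a finite union of closed pieces, so every piece is clopen;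
  a connected nonempty clopen set is a component.\<close>

lemma connected_components_of_finite_partition:
  assumes "finite C" and "disjoint C" and "\<Union>C = topspace Z"
    and C: "\<And>c. c \<in> C \<Longrightarrow> connectedin Z c \<and> closedin Z c \<and> c \<noteq> {}"
  shows "connected_components_of Z = C"
proof -
  have comp: "connected_component_of_set Z x = c" if "c \<in> C" "x \<in> c" for c x
  proof -
    have "closedin Z (\<Union>(C - {c}))"
      using assms(1) C by (intro closedin_Union) auto
    moreover have "c = topspace Z - \<Union>(C - {c})"
      using that assms(2,3) by (auto dest: disjointD)
    ultimately have "openin Z c"
      by (metis openin_closedin_eq openin_diff openin_topspace)
    then have "connected_component_of_set Z x \<subseteq> c \<or> disjnt (connected_component_of_set Z x) c"
      using C that connectedin_clopen_cases connectedin_connected_component_of by metis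
    moreover have "c \<subseteq> connected_component_of_set Z x"
      using C that connected_component_of_maximal by metis
    ultimately show ?thesis
      using that by (auto simp: disjnt_def)
  qed
  have "connected_components_of Z = connected_component_of_set Z ` \<Union>C"
    using assms(3) by (simp add: connected_components_of_def)
  also have "\<dots> = C"
  proof
    show "connected_component_of_set Z ` \<Union>C \<subseteq> C"
      using comp by auto
    show "C \<subseteq> connected_component_of_set Z ` \<Union>C"
    proof
      fix c assume "c \<in> C"
      then obtain x where "x \<in> c" using C by blast
      then show "c \<in> connected_component_of_set Z ` \<Union>C"
        using comp[OF \<open>c \<in> C\<close>] \<open>c \<in> C\<close> by (intro image_eqI[of _ _ x]) auto
    qed
  qed
  finally show ?thesis .
qed

text \<open>The boundary of a disjoint union of discs is the disjoint union of their circles, one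
  connected component for each disc.\<close>

lemma card_boundary_components_disjoint_discs:
  assumes Y: "surface_boundary Y = {}" "Hausdorff_space Y"
    and P: "finite P" "disjoint P" "\<And>c. c \<in> P \<Longrightarrow> closed_disc_in Y c"
  shows "card (boundary_components (subtopology Y (\<Union>P))) = card P"
proof -
  have sub: "\<Union>P \<subseteq> topspace Y"
    using P(3) by (auto simp: closed_disc_in_def)
  have bd: "disc_boundary Y c = c - Y interior_of c" if "c \<in> P" for c
    using disc_boundary_eq[OF Y(1) P(3)[OF that]] .
  have int: "Y interior_of \<Union>P \<inter> c = Y interior_of c" if "c \<in> P" for c
  proof
    \<comment> \<open>Taking the other discs away from the interior of the union leaves an open set
      contained in \<open>c\<close>.\<close>
    have "closedin Y (\<Union>(P - {c}))"
      using P closedin_disc[OF Y(2)] by (intro closedin_Union) auto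
    then have "openin Y (Y interior_of \<Union>P - \<Union>(P - {c}))"
      by (simp add: openin_diff)
    moreover have "Y interior_of \<Union>P - \<Union>(P - {c}) \<subseteq> c"
      using interior_of_subset[of Y "\<Union>P"] by blast
    ultimately have "Y interior_of \<Union>P - \<Union>(P - {c}) \<subseteq> Y interior_of c"
      using interior_of_maximal by blast
    moreover have "c \<inter> \<Union>(P - {c}) = {}"
      using that P(2) by (auto dest: disjointD)
    ultimately show "Y interior_of \<Union>P \<inter> c \<subseteq> Y interior_of c"
      by blast
    show "Y interior_of c \<subseteq> Y interior_of \<Union>P \<inter> c"
      using that interior_of_mono[of c "\<Union>P" Y] interior_of_subset[of Y c] by blast
  qed
  define B where "B = \<Union>(disc_boundary Y ` P)"
  have "\<Union>P - Y interior_of \<Union>P = B"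
    using int bd by (auto simp: B_def)
  then have boundary: "surface_boundary (subtopology Y (\<Union>P)) = B"
    using surface_boundary_subtopology[OF Y(1) sub] by simp
  have BP: "B \<subseteq> \<Union>P"
    using bd by (auto simp: B_def)
  have "connected_components_of (subtopology Y B) = disc_boundary Y ` P"
  proof (rule connected_components_of_finite_partition)
    show "finite (disc_boundary Y ` P)"
      using P(1) by simp
    show "disjoint (disc_boundary Y ` P)"
      using P(2) bd by (intro disjointI) (auto dest: disjointD)
    show "\<Union>(disc_boundary Y ` P) = topspace (subtopology Y B)"
      using BP sub by (auto simp: B_def)
    fix b assume "b \<in> disc_boundary Y ` P"
    then obtain c where c: "c \<in> P" "b = disc_boundary Y c" by blast
    have "closedin Y b"
      using c bd closedin_disc[OF Y(2) P(3)] by (simp add: closedin_diff)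
    moreover have "b \<subseteq> B"
      using c by (auto simp: B_def)
    ultimately show "connectedin (subtopology Y B) b \<and> closedin (subtopology Y B) b \<and> b \<noteq> {}"
      using connectedin_disc_boundary[OF P(3)] disc_boundary_nonempty[OF P(3)] c
      by (auto simp: connectedin_subtopology closedin_subset_topspace intro: closedin_subset_topspace)
  qed
  moreover have "subtopology (subtopology Y (\<Union>P)) B = subtopology Y B"
    using BP by (simp add: subtopology_subtopology inf_absorb2)
  moreover have "inj_on (disc_boundary Y) P"
  proof (rule inj_onI)
    fix c d assume "c \<in> P" "d \<in> P" "disc_boundary Y c = disc_boundary Y d"
    then show "c = d"
      using disc_boundary_nonempty[OF P(3)] disc_boundary_subset[OF P(3)] disjointD[OF P(2)]
      by (metis Int_greatest subset_empty)
  qed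
  ultimately show ?thesis
    by (simp add: boundary_components_def boundary card_image)
qed

lemma card_boundary_components_homeomorphic:
  assumes "homeomorphic_map X X' f"
  shows "card (boundary_components X') = card (boundary_components X)"
proof -
  have "f ` (topspace X \<inter> surface_boundary X) = topspace X' \<inter> surface_boundary X'"
    using surface_boundary_subset[of X] surface_boundary_subset[of X']
      surface_boundary_homeomorphic_map[OF assms] by (simp add: inf_absorb2)
  from homeomorphic_map_subtopologies[OF assms this]
  have h: "homeomorphic_map (subtopology X (surface_boundary X))
      (subtopology X' (surface_boundary X')) f" .
  have "inj_on f (topspace (subtopology X (surface_boundary X)))"
    using homeomorphic_imp_injective_map[OF h] .
  then have "inj_on ((`) f) (boundary_components X)"
    unfolding boundary_components_def
    by (meson connected_components_of_subset inj_on_image_eq_iff inj_onI)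
  then show ?thesis
    by (simp add: boundary_components_def homeomorphic_map_connected_components_of[OF h] card_image)
qed

text \<open>The situation is symmetric in \<open>P\<close> and \<open>Q\<close>: both subsurfaces
  have boundary \<open>\<Union>P \<inter> \<Union>Q\<close>, with the same topology inherited from
  \<open>Y\<close>.\<close>

lemma boundary_components_complementary_discs:
  assumes Y: "surface_boundary Y = {}" "Hausdorff_space Y"
    and fin: "finite P" "finite Q"
    and discs: "\<And>c. c \<in> P \<Longrightarrow> closed_disc_in Y c" "\<And>d. d \<in> Q \<Longrightarrow> closed_disc_in Y d"
    and cover: "\<Union>P \<union> \<Union>Q = topspace Y"
    and dis: "\<And>c d. \<lbrakk>c \<in> P; d \<in> Q\<rbrakk> \<Longrightarrow> Y interior_of c \<inter> Y interior_of d = {}"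
  shows "boundary_components (subtopology Y (\<Union>P)) = boundary_components (subtopology Y (\<Union>Q))"
proof -
  define B where "B = \<Union>P \<inter> \<Union>Q"
  have "\<Union>P - Y interior_of \<Union>P = B"
    unfolding B_def by (rule Union_discs_minus_interior[OF Y fin(2) discs(2,1) cover dis])
  moreover have "\<Union>Q - Y interior_of \<Union>Q = \<Union>Q \<inter> \<Union>P"
    using dis by (intro Union_discs_minus_interior[OF Y fin(1) discs]) (use cover in auto)
  moreover have sub: "\<Union>P \<subseteq> topspace Y" "\<Union>Q \<subseteq> topspace Y"
    using cover by auto
  ultimately have "surface_boundary (subtopology Y (\<Union>P)) = B"
    "surface_boundary (subtopology Y (\<Union>Q)) = B"
    using surface_boundary_subtopology[OF Y(1)] by (auto simp: B_def)
  then show ?thesis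
    by (simp add: boundary_components_def subtopology_subtopology B_def inf_absorb2)
qed

section \<open>Isomorphic graphs\<close>

text \<open>Paths are pushed forward along \<open>f\<close> and lifted back along it, so
  \<open>f\<close> induces a bijection between the components of the two spanning subgraphs.\<close>

lemma graph_rank_isomorphic:
  fixes H :: "('v, 'e) multigraph" and H' :: "('w, 'f) multigraph"
  assumes f: "bij_betw f (nodes H) (nodes H')"
    and sub: "\<And>e. e \<in> A \<Longrightarrow> ends H e \<subseteq> nodes H"
    and ends: "\<And>e. e \<in> A \<Longrightarrow> ends H' (g e) = f ` ends H e"
  shows "graph_rank H' (g ` A) = graph_rank H A"
proof -
  define R where "R = {(a, b). \<exists>e \<in> A. ends H e = {a, b}}"
  define R' where "R' = {(a, b). \<exists>e \<in> g ` A. ends H' e = {a, b}}"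
  define E where "E = {(u, v) \<in> nodes H \<times> nodes H. (u, v) \<in> R\<^sup>*}"
  define E' where "E' = {(u, v) \<in> nodes H' \<times> nodes H'. (u, v) \<in> R'\<^sup>*}"
  have inj: "inj_on f (nodes H)" and im: "f ` nodes H = nodes H'"
    using f by (auto simp: bij_betw_def)
  have fwd: "(f u, f v) \<in> R'\<^sup>*" if "(u, v) \<in> R\<^sup>*" for u v
    using that
  proof (induction rule: rtrancl_induct)
    case (step y z)
    then obtain e where "e \<in> A" "ends H e = {y, z}"
      by (auto simp: R_def)
    then have "(f y, f z) \<in> R'"
      using ends[of e] by (auto simp: R'_def intro!: bexI[of _ e])
    with step.IH show ?case by (rule rtrancl_into_rtrancl)
  qed simp
  have bwd: "\<exists>v \<in> nodes H. f v = y \<and> (u, v) \<in> R\<^sup>*" if "(f u, y) \<in> R'\<^sup>*" "u \<in> nodes H" for u y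
    using that(1)
  proof (induction rule: rtrancl_induct)
    case base
    show ?case using that(2) by auto
  next
    case (step y z)
    then obtain v where v: "v \<in> nodes H" "f v = y" "(u, v) \<in> R\<^sup>*" by blast
    from step obtain e where e: "e \<in> A" "f ` ends H e = {y, z}"
      using ends by (auto simp: R'_def)
    \<comment> \<open>To lift the last edge of the path, choose preimages of its ends among the ends
      of \<open>e\<close>. Injectivity of \<open>f\<close> identifies \<open>a\<close> with the node
      \<open>v\<close> already reached and rules out a third end of \<open>e\<close>; a loop gives
      \<open>b = v\<close>.\<close>
    then obtain a b where ab: "a \<in> ends H e" "f a = y" "b \<in> ends H e" "f b = z"
      by (metis imageE insertI1 insertI2)
    have "a = v"
      using ab v sub[OF e(1)] inj by (auto dest: inj_onD)
    have "x = v \<or> x = b" if "x \<in> ends H e" for x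
    proof -
      have "f x \<in> {y, z}"
        using that unfolding e(2)[symmetric] by (rule imageI)
      then have "f x = f v \<or> f x = f b"
        using ab v by simp
      then show ?thesis
        using inj that ab v sub[OF e(1)] by (auto dest: inj_onD)
    qed
    then have "ends H e = {v, b}"
      using ab \<open>a = v\<close> by blast
    then have "(v, b) \<in> R"
      using e by (auto simp: R_def)
    with v(3) have "(u, b) \<in> R\<^sup>*"
      by (rule rtrancl_into_rtrancl)
    moreover have "b \<in> nodes H"
      using ab sub[OF e(1)] by (auto intro: subsetD)
    ultimately show ?case
      using ab(4) by (intro bexI[of _ b]) simp_all
  qed
  have class_image: "E' `` {f u} = f ` (E `` {u})" if "u \<in> nodes H" for u
  proof
    show "E' `` {f u} \<subseteq> f ` (E `` {u})"
      using bwd that by (fastforce simp: E_def E'_def)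
    show "f ` (E `` {u}) \<subseteq> E' `` {f u}"
      using fwd that im by (auto simp: E_def E'_def)
  qed
  have "nodes H' // E' = (`) f ` (nodes H // E)"
    using class_image by (auto simp: quotient_def im[symmetric])
  moreover have "inj_on ((`) f) (nodes H // E)"
    by (rule inj_on_image, rule inj_on_subset[OF inj]) (auto simp: quotient_def E_def)
  ultimately have "card (nodes H' // E') = card (nodes H // E)"
    by (simp add: card_image)
  then show ?thesis
    using bij_betw_same_card[OF f]
    by (simp add: graph_rank_def graph_components_def spanning_subgraph_def
        E_def E'_def R_def R'_def)
qed

section \<open>A ribbon graph and its dual inside a closed surface\<close>

text \<open>Fixes a closed surface \<open>Y\<close> of the kind that \<open>geometric_dual\<close>
  provides, so that the image of \<open>G\<close> and the dual \<open>H\<close> can be compared as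
  subspaces of one ambient space.\<close>

locale capped_ribbon_graph =
  fixes G :: "'a ribbon_graph" and i :: "'a \<Rightarrow> 'b" and H :: "'b ribbon_graph"
    and Y :: "'b topology"
  assumes ribbon: "ribbon_graph G"
    and closed: "closed_surface Y"
    and emb: "embedding_map (surface G) Y i"
    and cover: "topspace Y = i ` topspace (surface G) \<union> \<Union>(verts H)"
    and finite_caps: "finite (verts H)"
    and caps: "\<And>D. D \<in> verts H \<Longrightarrow> closed_disc_in Y D"
    and cap_inter: "\<And>D. D \<in> verts H \<Longrightarrow> D \<inter> i ` topspace (surface G) = disc_boundary Y D"
    and cap_bij: "bij_betw (disc_boundary Y) (verts H) ((`) i ` boundary_components (surface G))"
    and edges_dual: "edges H = (`) i ` edges G"
    and surface_dual: "surface H = subtopology Y (\<Union>(verts H) \<union> \<Union>(edges H))"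

lemma geometric_dual_capped:
  assumes "ribbon_graph G" "geometric_dual G i H"
  obtains Y where "capped_ribbon_graph G i H Y"
  using assms unfolding geometric_dual_def capped_ribbon_graph_def by metis

context capped_ribbon_graph
begin

lemma no_boundary: "surface_boundary Y = {}"
  using closed by (simp add: closed_surface_def)

lemma Hausdorff: "Hausdorff_space Y"
  using closed by (simp add: closed_surface_def surface_with_boundary_def)

lemma inj: "inj_on i (topspace (surface G))"
  using emb homeomorphic_imp_injective_map unfolding embedding_map_def by metis

lemma finite_discs: "finite (verts G)" "finite (edges G)"
  using ribbon by (simp_all add: ribbon_graph_def)

lemma disjoint_discs: "disjoint (verts G)" "disjoint (edges G)"
  using ribbon by (simp_all add: ribbon_graph_def)

lemma topspace_eq: "topspace (surface G) = \<Union>(verts G) \<union> \<Union>(edges G)"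
  using ribbon by (simp add: ribbon_graph_def)

lemma disc: "D \<in> verts G \<union> edges G \<Longrightarrow> closed_disc_in (surface G) D"
  using ribbon by (simp add: ribbon_graph_def)

lemma disc_subset: "D \<in> verts G \<union> edges G \<Longrightarrow> D \<subseteq> topspace (surface G)"
  using disc by (simp add: closed_disc_in_def)

section \<open>Carrying the discs of \<open>G\<close> into the closed surface\<close>

lemma homeomorphic_image:
  assumes "S \<subseteq> topspace (surface G)"
  shows "homeomorphic_map (subtopology (surface G) S) (subtopology Y (i ` S)) i"
proof -
  let ?I = "i ` topspace (surface G)"
  have I: "?I \<subseteq> topspace Y"
    using cover by blast
  have S: "i ` S \<subseteq> ?I"
    using assms by blast
  have "i ` (topspace (surface G) \<inter> S) = topspace (subtopology Y ?I) \<inter> i ` S"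
    using assms I S by (simp add: inf_absorb2)
  then have "homeomorphic_map (subtopology (surface G) S) (subtopology (subtopology Y ?I) (i ` S)) i"
    using emb homeomorphic_map_subtopologies unfolding embedding_map_def by metis
  then show ?thesis
    using S by (simp add: subtopology_subtopology inf_absorb2)
qed

lemma disc_image:
  assumes "D \<in> verts G \<union> edges G"
  shows "closed_disc_in Y (i ` D)"
    and "disc_boundary Y (i ` D) = i ` disc_boundary (surface G) D"
proof -
  note h = homeomorphic_image[OF disc_subset[OF assms]]
  have "subtopology Y (i ` D) homeomorphic_space top_of_set (cball (0 :: complex) 1)"
    using disc[OF assms] homeomorphic_map_imp_homeomorphic_space[OF h]
      homeomorphic_space_sym homeomorphic_space_trans
    unfolding closed_disc_in_def by metis
  moreover have "i ` D \<subseteq> topspace Y"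
    using disc_subset[OF assms] cover by blast
  ultimately show "closed_disc_in Y (i ` D)"
    by (simp add: closed_disc_in_def)
  show "disc_boundary Y (i ` D) = i ` disc_boundary (surface G) D"
    using surface_boundary_homeomorphic_map[OF h] by (simp add: disc_boundary_def)
qed

lemma image_disjoint:
  assumes "C \<subseteq> topspace (surface G)" "D \<subseteq> topspace (surface G)" "C \<inter> D = {}"
  shows "i ` C \<inter> i ` D = {}"
  using inj_on_image_Int[OF inj assms(1,2)] assms(3) by simp

lemma inj_image: "inj_on ((`) i) (verts G \<union> edges G)"
  by (rule inj_on_image, rule inj_on_subset[OF inj]) (use disc_subset in blast)

section \<open>The discs in \<open>Y\<close> have disjoint interiors\<close>

text \<open>A common point lies on one of the attaching segments, which is part of the boundary of
  some vertex; since vertices are disjoint, that vertex is \<open>v\<close>.\<close>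

lemma vertex_inter_edge:
  assumes "v \<in> verts G" "e \<in> edges G"
  shows "v \<inter> e \<subseteq> disc_boundary (surface G) v"
proof
  fix p assume p: "p \<in> v \<inter> e"
  obtain L where L: "\<Union>(verts G) \<inter> \<Union>(edges G) = \<Union>L"
    and segments: "\<forall>l \<in> L. line_segment_in (surface G) l \<and>
      (\<exists>!v. v \<in> verts G \<and> l \<subseteq> disc_boundary (surface G) v) \<and>
      (\<exists>!e. e \<in> edges G \<and> l \<subseteq> disc_boundary (surface G) e)"
    using ribbon unfolding ribbon_graph_def by (elim conjE exE) (rule that)
  have "p \<in> \<Union>L"
    using p assms unfolding L[symmetric] by blast
  then obtain l where l: "l \<in> L" "p \<in> l" ..
  then have "\<exists>v. v \<in> verts G \<and> l \<subseteq> disc_boundary (surface G) v"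
    using segments by (simp add: Ex1_def) metis
  then obtain v' where v': "v' \<in> verts G" "p \<in> disc_boundary (surface G) v'"
    using l(2) by (elim exE conjE) (rule that, auto)
  then have "p \<in> v'"
    using disc_boundary_subset[OF disc] by blast
  then have "v' = v"
    using disjointD[OF disjoint_discs(1) v'(1) assms(1)] p by blast
  then show "p \<in> disc_boundary (surface G) v"
    using v' by simp
qed

lemma interiors_vertex_edge:
  assumes "v \<in> verts G" "e \<in> edges G"
  shows "Y interior_of (i ` v) \<inter> Y interior_of (i ` e) = {}"
proof -
  have "i ` v \<inter> i ` e = i ` (v \<inter> e)"
    using inj_on_image_Int[OF inj] disc_subset assms by simp
  also have "\<dots> \<subseteq> disc_boundary Y (i ` v)"
    using vertex_inter_edge[OF assms] assms by (simp add: disc_image image_mono)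
  also have "\<dots> = i ` v - Y interior_of (i ` v)"
    using assms by (intro disc_boundary_eq[OF no_boundary] disc_image) simp
  finally show ?thesis
    using interior_of_subset[of Y "i ` v"] interior_of_subset[of Y "i ` e"] by blast
qed

lemma interiors_edge_edge:
  assumes "e \<in> edges G" "e' \<in> edges G" "e \<noteq> e'"
  shows "Y interior_of (i ` e) \<inter> Y interior_of (i ` e') = {}"
proof -
  have "i ` e \<inter> i ` e' = {}"
    using assms disjointD[OF disjoint_discs(2)] by (intro image_disjoint disc_subset) auto
  then show ?thesis
    using interior_of_subset[of Y "i ` e"] interior_of_subset[of Y "i ` e'"] by blast
qed

text \<open>By \<open>cap_inter\<close>, a cap meets the image of \<open>G\<close> only along its
  own boundary circle, which misses its interior.\<close>

lemma interiors_cap: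
  assumes "D \<in> verts H" "c \<in> verts G \<union> edges G"
  shows "Y interior_of (i ` c) \<inter> Y interior_of D = {}"
proof -
  have "D \<inter> i ` c \<subseteq> D \<inter> i ` topspace (surface G)"
    using disc_subset[OF assms(2)] by blast
  also have "\<dots> = D - Y interior_of D"
    using cap_inter[OF assms(1)] disc_boundary_eq[OF no_boundary caps[OF assms(1)]] by simp
  finally show ?thesis
    using interior_of_subset[of Y "i ` c"] interior_of_subset[of Y D] by blast
qed

section \<open>Boundary counts and \<open>rho\<close> under duality\<close>

lemma num_boundary_image:
  assumes "A \<subseteq> edges G"
  shows "num_boundary G A = card (boundary_components (subtopology Y (\<Union>((`) i ` (verts G \<union> A)))))"
proof -
  have "\<Union>(verts G) \<union> \<Union>A \<subseteq> topspace (surface G)"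
    using assms topspace_eq by blast
  moreover have "i ` (\<Union>(verts G) \<union> \<Union>A) = \<Union>((`) i ` (verts G \<union> A))"
    by blast
  ultimately show ?thesis
    using card_boundary_components_homeomorphic[OF homeomorphic_image]
    unfolding num_boundary_def subgraph_surface_def by metis
qed

text \<open>The vertices of \<open>G\<close> with the edges in \<open>A\<close>, and the caps with
  the remaining edges, form two complementary families of discs that cover \<open>Y\<close>.\<close>

lemma num_boundary_dual:
  assumes A: "A \<subseteq> edges G"
  shows "num_boundary H ((`) i ` (edges G - A)) = num_boundary G A"
proof -
  define P where "P = (`) i ` (verts G \<union> A)"
  define Q where "Q = verts H \<union> (`) i ` (edges G - A)"
  have dis: "Y interior_of c \<inter> Y interior_of d = {}" if "c \<in> P" "d \<in> Q" for c d
  proof -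
    obtain c' where c': "c = i ` c'" "c' \<in> verts G \<union> A"
      using \<open>c \<in> P\<close> by (auto simp: P_def)
    show ?thesis
    proof (cases "d \<in> verts H")
      case True
      then show ?thesis using interiors_cap c' A by blast
    next
      case False
      \<comment> \<open>Since \<open>e\<close> is outside \<open>A\<close>, it differs from
        \<open>c'\<close> even if \<open>c'\<close> is an edge.\<close>
      then obtain e where "d = i ` e" "e \<in> edges G" "e \<notin> A"
        using \<open>d \<in> Q\<close> by (auto simp: Q_def)
      then show ?thesis
        using c' A interiors_vertex_edge interiors_edge_edge by (metis UnE subsetD)
    qed
  qed
  have "P \<union> Q = (`) i ` (verts G \<union> edges G) \<union> verts H"
    using A by (auto simp: P_def Q_def)
  then have "\<Union>P \<union> \<Union>Q = topspace Y"
    unfolding cover topspace_eq by (simp add: image_Un image_Union flip: Union_Un_distrib)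
  then have "boundary_components (subtopology Y (\<Union>P)) = boundary_components (subtopology Y (\<Union>Q))"
  proof (intro boundary_components_complementary_discs[OF no_boundary Hausdorff] dis)
    show "finite P" "finite Q"
      using finite_discs finite_caps A by (auto simp: P_def Q_def intro: finite_subset)
    show "closed_disc_in Y c" if "c \<in> P" for c
      using that A disc_image(1) by (auto simp: P_def)
    show "closed_disc_in Y d" if "d \<in> Q" for d
      using that A disc_image(1) caps by (auto simp: Q_def)
  qed
  moreover have "subgraph_surface H ((`) i ` (edges G - A)) = subtopology Y (\<Union>Q)"
  proof -
    have "\<Union>Q \<subseteq> \<Union>(verts H) \<union> \<Union>(edges H)"
      by (auto simp: Q_def edges_dual)
    then show ?thesis
      by (simp add: subgraph_surface_def surface_dual subtopology_subtopology inf_absorb2 Q_def)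
  qed
  ultimately show ?thesis
    using num_boundary_image[OF A] by (simp add: num_boundary_def P_def)
qed

text \<open>The vertices alone are disjoint discs. Through \<open>num_boundary_dual\<close> this
  also counts the boundary components of the whole dual.\<close>

lemma num_boundary_empty: "num_boundary G {} = card (verts G)"
proof -
  have "disjoint ((`) i ` verts G)"
  proof (rule disjointI)
    fix a b assume "a \<in> (`) i ` verts G" "b \<in> (`) i ` verts G" "a \<noteq> b"
    then obtain u v where "a = i ` u" "b = i ` v" "u \<in> verts G" "v \<in> verts G" "u \<noteq> v"
      by blast
    then show "a \<inter> b = {}"
      using disjointD[OF disjoint_discs(1)] image_disjoint disc_subset by simp
  qed
  then have "num_boundary G {} = card ((`) i ` verts G)"
    using card_boundary_components_disjoint_discs[OF no_boundary Hausdorff, of "(`) i ` verts G"]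
      num_boundary_image[of "{}"] finite_discs disc_image(1) by auto
  then show ?thesis
    using inj_on_subset[OF inj_image] by (simp add: card_image)
qed

lemma card_verts_dual: "card (verts H) = num_boundary G (edges G)"
proof -
  have "\<Union>(boundary_components (surface G)) \<subseteq> topspace (surface G)"
    unfolding boundary_components_def Union_connected_components_of by simp
  then have "inj_on ((`) i) (boundary_components (surface G))"
    by (intro inj_on_image inj_on_subset[OF inj])
  then have "card (verts H) = card (boundary_components (surface G))"
    using bij_betw_same_card[OF cap_bij] by (simp add: card_image)
  then show ?thesis
    by (simp add: num_boundary_def subgraph_surface_def flip: topspace_eq)
qed

lemma card_edges_dual:
  assumes "A \<subseteq> edges G"
  shows "card ((`) i ` A) = card A"
  by (rule card_image, rule inj_on_subset[OF inj_image]) (use assms in blast)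

text \<open>Corank and nullity trade places, as for dual matroids. Both identities are arithmetic
  from three counts: complementary edge sets have equally many boundary components, \<open>H\<close>
  has as many vertices as \<open>G\<close> has boundary components, and \<open>G\<close> has as many
  vertices as \<open>H\<close> has boundary components.\<close>

lemma rho_dual:
  assumes "A \<subseteq> edges G"
  shows "rho H (edges H) - rho H ((`) i ` (edges G - A)) = of_nat (card A) - rho G A"
    and "of_nat (card ((`) i ` (edges G - A))) - rho H ((`) i ` (edges G - A))
      = rho G (edges G) - rho G A"
proof -
  have "card (edges G - A) + card A = card (edges G)"
    using assms finite_discs by (metis card_Diff_subset card_mono finite_subset le_add_diff_inverse2)
  then have card: "(of_nat (card (edges G - A)) :: rat) = of_nat (card (edges G)) - of_nat (card A)"
    by (metis add_diff_cancel_right' of_nat_add)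
  have "num_boundary H (edges H) = card (verts G)"
    using num_boundary_dual[of "{}"] by (simp add: num_boundary_empty edges_dual)
  then show "rho H (edges H) - rho H ((`) i ` (edges G - A)) = of_nat (card A) - rho G A"
    using num_boundary_dual[OF assms]
    by (simp add: rho_def card card_edges_dual edges_dual field_simps)
  show "of_nat (card ((`) i ` (edges G - A))) - rho H ((`) i ` (edges G - A))
      = rho G (edges G) - rho G A"
    using num_boundary_dual[OF assms]
    by (simp add: rho_def card card_edges_dual card_verts_dual field_simps)
qed

section \<open>The graphs on colour classes and the two polynomials\<close>

text \<open>Replacing each vertex by its boundary circle is an isomorphism of the class graphs: an
  edge meets a vertex exactly when its image meets the image of the circle.\<close>

lemma graph_rank_dual:
  assumes \<V>: "partition_on (verts G) \<V>" and A: "A \<subseteq> edges G"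
  shows "graph_rank (boundary_class_graph H (dual_colouring G i \<V>)) ((`) i ` A)
    = graph_rank (vertex_class_graph G \<V>) A"
proof (rule graph_rank_isomorphic)
  define \<beta> where "\<beta> v = i ` disc_boundary (surface G) v" for v
  have classes: "\<Union>\<V> = verts G"
    using \<V> by (simp add: partition_on_def)
  have sub: "disc_boundary (surface G) v \<subseteq> v" if "v \<in> verts G" for v
    using that disc disc_boundary_subset by blast
  \<comment> \<open>A circle shared by two vertices is nonempty and lies in both images, so the
    vertices meet and hence coincide.\<close>
  have "inj_on \<beta> (verts G)"
  proof (rule inj_onI)
    fix u v assume uv: "u \<in> verts G" "v \<in> verts G" "\<beta> u = \<beta> v"
    have "\<beta> u \<subseteq> i ` u" "\<beta> u \<subseteq> i ` v" "\<beta> u \<noteq> {}"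
      using uv sub disc_boundary_nonempty[OF disc, of u] by (auto simp: \<beta>_def)
    then have "i ` u \<inter> i ` v \<noteq> {}"
      by blast
    then have "u \<inter> v \<noteq> {}"
      using image_disjoint[OF disc_subset disc_subset, of u v] uv by auto
    then show "u = v"
      using disjointD[OF disjoint_discs(1)] uv by blast
  qed
  then have "inj_on ((`) \<beta>) \<V>"
    by (intro inj_on_image) (simp add: classes)
  then show "bij_betw ((`) \<beta>) (nodes (vertex_class_graph G \<V>))
      (nodes (boundary_class_graph H (dual_colouring G i \<V>)))"
    by (simp add: vertex_class_graph_def boundary_class_graph_def dual_colouring_def
        bij_betw_def \<beta>_def[abs_def])
  fix e assume e: "e \<in> A"
  show "ends (vertex_class_graph G \<V>) e \<subseteq> nodes (vertex_class_graph G \<V>)"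
    by (auto simp: vertex_class_graph_def)
  have meet: "\<beta> v \<inter> i ` e \<noteq> {} \<longleftrightarrow> v \<inter> e \<noteq> {}" if "v \<in> verts G" for v
  proof
    assume "\<beta> v \<inter> i ` e \<noteq> {}"
    then have "i ` v \<inter> i ` e \<noteq> {}"
      using sub[OF that] by (auto simp: \<beta>_def)
    then show "v \<inter> e \<noteq> {}"
      using image_disjoint[OF disc_subset disc_subset, of v e] that e A by auto
  next
    \<comment> \<open>This direction uses the fact that vertices and edges meet only on the boundary
      of the vertex.\<close>
    assume "v \<inter> e \<noteq> {}"
    then show "\<beta> v \<inter> i ` e \<noteq> {}"
      using vertex_inter_edge[OF that, of e] e A by (auto simp: \<beta>_def)
  qed
  have class_meet: "(\<exists>C \<in> \<beta> ` c. C \<inter> i ` e \<noteq> {}) \<longleftrightarrow> (\<exists>v \<in> c. v \<inter> e \<noteq> {})" if "c \<in> \<V>" for c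
  proof -
    have "v \<in> verts G" if "v \<in> c" for v
      using that \<open>c \<in> \<V>\<close> classes by auto
    then show ?thesis
      by (simp add: meet cong: bex_cong)
  qed
  have "{C \<in> (`) \<beta> ` \<V>. \<exists>D \<in> C. D \<inter> i ` e \<noteq> {}} = (`) \<beta> ` {c \<in> \<V>. \<exists>v \<in> c. v \<inter> e \<noteq> {}}"
    unfolding Compr_image_eq by (rule arg_cong[where f = "(`) ((`) \<beta>)"], rule Collect_cong, rule conj_cong[OF refl],
        rule class_meet)
  then show "ends (boundary_class_graph H (dual_colouring G i \<V>)) (i ` e)
      = (`) \<beta> ` ends (vertex_class_graph G \<V>) e"
    by (simp add: vertex_class_graph_def boundary_class_graph_def dual_colouring_def \<beta>_def[abs_def])
qed

lemma T_cps_dual: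
  assumes \<V>: "partition_on (verts G) \<V>"
  shows "T_cps G \<V> w x y = T_s H (dual_colouring G i \<V>) y w x"
proof -
  let ?\<B> = "dual_colouring G i \<V>"
  have inj_edges: "inj_on ((`) i) (edges G)"
    by (rule inj_on_subset[OF inj_image]) simp
  \<comment> \<open>Reindexes the sum: the term of \<open>T_cps\<close> at \<open>A\<close> is
    matched with the term of \<open>T_s\<close> at the dual edges coming from outside
    \<open>A\<close>.\<close>
  define \<phi> where "\<phi> A = (`) i ` (edges G - A)" for A
  have "bij_betw \<phi> (Pow (edges G)) (Pow (edges H))"
  proof -
    have "bij_betw (\<lambda>A. edges G - A) (Pow (edges G)) (Pow (edges G))"
      by (rule bij_betw_byWitness[where f' = "\<lambda>A. edges G - A"]) auto
    moreover have "bij_betw ((`) ((`) i)) (Pow (edges G)) (Pow (edges H))"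
      using inj_edges by (intro bij_betw_Pow) (simp add: bij_betw_def edges_dual)
    ultimately have "bij_betw ((`) ((`) i) \<circ> (\<lambda>A. edges G - A)) (Pow (edges G)) (Pow (edges H))"
      by (rule bij_betw_trans)
    then show ?thesis
      by (simp add: \<phi>_def[abs_def] comp_def)
  qed
  then have "T_s H ?\<B> y w x = (\<Sum>A \<in> Pow (edges G).
        var_power y (rho H (edges H) - rho H (\<phi> A)) *
        var_power w (rank3 H ?\<B> (\<phi> A)) *
        var_power x (rank4 H ?\<B> (\<phi> A)))"
    unfolding T_s_def by (rule sum.reindex_bij_betw[symmetric])
  also have "\<dots> = T_cps G \<V> w x y"
    unfolding T_cps_def
  proof (rule sum.cong[OF refl])
    fix A assume "A \<in> Pow (edges G)"
    then have A: "A \<subseteq> edges G" by simp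
    \<comment> \<open>Both \<open>rank3\<close> and \<open>rank4\<close> evaluate the class graph on
      the complement of their argument, so the two complements cancel and the ranks become those of
      \<open>A\<close> in \<open>G\<close>.\<close>
    have "edges H - \<phi> A = (`) i ` (edges G - (edges G - A))"
      unfolding \<phi>_def edges_dual by (rule inj_on_image_set_diff[OF inj_edges, symmetric]) auto
    also have "edges G - (edges G - A) = A"
      using A by blast
    finally have compl: "edges H - \<phi> A = (`) i ` A" .
    have r: "graph_rank (boundary_class_graph H ?\<B>) (edges H - \<phi> A)
        = graph_rank (vertex_class_graph G \<V>) A"
      "graph_rank (boundary_class_graph H ?\<B>) (edges H)
        = graph_rank (vertex_class_graph G \<V>) (edges G)"
      unfolding compl using graph_rank_dual[OF \<V>] A by (simp_all add: edges_dual)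
    have "rank3 H ?\<B> (\<phi> A) = rank1 G \<V> (edges G) - rank1 G \<V> A"
      unfolding rank3_def rank1_def r ..
    \<comment> \<open>The nullity of \<open>\<phi> A\<close> in \<open>H\<close> is the corank of
      \<open>A\<close> in \<open>G\<close>; the same difference of class graph ranks is subtracted
      on both sides.\<close>
    moreover have "rank4 H ?\<B> (\<phi> A) = rank2 G \<V> (edges G) - rank2 G \<V> A"
      unfolding rank4_def rank2_def r using rho_dual(2)[OF A] by (simp add: \<phi>_def)
    moreover have "rho H (edges H) - rho H (\<phi> A) = of_nat (card A) - rho G A"
      using rho_dual(1)[OF A] by (simp add: \<phi>_def)
    ultimately show "var_power y (rho H (edges H) - rho H (\<phi> A)) *
        var_power w (rank3 H ?\<B> (\<phi> A)) * var_power x (rank4 H ?\<B> (\<phi> A)) =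
        var_power w (rank1 G \<V> (edges G) - rank1 G \<V> A) *
        var_power x (rank2 G \<V> (edges G) - rank2 G \<V> A) *
        var_power y (of_nat (card A) - rho G A)"
      by (simp add: mult_ac)
  qed
  finally show ?thesis ..
qed

end

theorem theorem4p9:
  fixes G :: "'a ribbon_graph" and \<V> :: "'a set set set"
    and H :: "'b ribbon_graph" and \<B> :: "'b set set set"
    and w x y :: 'v
  assumes "vertex_coloured G \<V>"
    and "coloured_dual G \<V> H \<B>"
  shows "T_cps G \<V> w x y = T_s H \<B> y w x"
proof -
  have G: "ribbon_graph G" "partition_on (verts G) \<V>"
    using assms(1) by (auto simp: vertex_coloured_def)
  obtain i where i: "geometric_dual G i H" "\<B> = dual_colouring G i \<V>"
    using assms(2) by (auto simp: coloured_dual_def)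
  obtain Y where "capped_ribbon_graph G i H Y"
    using geometric_dual_capped[OF G(1) i(1)] .
  then show ?thesis
    using capped_ribbon_graph.T_cps_dual G(2) i(2) by metis
qed

end
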